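(* Let $\Bbbk$ be a field of characteristic different from two. Let $f\colon\mathbb{N}\rightarrow\mathbb{N}$ be an increasing, polynomially bounded function such that $f(n)\succeq n^2$. Then there exists a finitely generated Jordan algebra $J$ over $\Bbbk$ such that $\gamma_J(n)\sim f(n)$.
   Context: A Jordan algebra over $\Bbbk$ is a (non-associative) $\Bbbk$-algebra with product $\circ$ satisfying $x\circ y=y\circ x$ and $(x\circ x)\circ(x\circ y)=x\circ((x\circ x)\circ y)$. Growth functions: if $A$ is a (not necessarily associative) $\Bbbk$-algebra generated by a finite set $X$, let $X^{\leq n}$ be the set of all products (with all arrangements of parentheses) of at most $n$ elements of $X$, and put $\gamma_{A,X}(n)=\dim_\Bbbk \operatorname{Span}_\Bbbk X^{\leq n}$ for $n\geq 1$. Asymptotic equivalence: for non-decreasing functions $f,g$ on the positive integers with values in the non-negative integers, $f\preceq g$ (equivalently $g\succeq f$) means that there are positive constants $C,D$ (with $D$ an integer) such that $f(n)\leq C g(Dn)$ for all $n\geq 1$; $f\sim g$ means $f\preceq g$ and $g\preceq f$. The $\sim$-class of $\gamma_{A,X}$ does not depend on the finite generating set $X$; one writes $\gamma_A$ for $\gamma_{A,X}$ with any choice of $X$. "Increasing" means strictly increasing. "Polynomially bounded" means that $f(n)\leq Kn^d$ for all $n\geq 1$, for some constants $K,d>0$. Functions are considered with arguments $n\geq 1$. *)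

theory Defs
  imports Complex_Main "HOL-Library.Poly_Mapping"
begin

locale nonassoc_algebra = vector_space scale
  for scale :: "'k::field \<Rightarrow> 'a::ab_group_add \<Rightarrow> 'a" +
  fixes mul :: "'a \<Rightarrow> 'a \<Rightarrow> 'a"  (infixl \<open>\<odot>\<close> 70)
  assumes mult_add_left: "(x + y) \<odot> z = x \<odot> z + y \<odot> z"
    and mult_add_right: "x \<odot> (y + z) = x \<odot> y + x \<odot> z"
    and mult_scale_left: "scale c x \<odot> y = scale c (x \<odot> y)"
    and mult_scale_right: "x \<odot> scale c y = scale c (x \<odot> y)"
begin

definition subalgebra :: "'a set \<Rightarrow> bool" where
  "subalgebra S \<longleftrightarrow> subspace S \<and> (\<forall>x\<in>S. \<forall>y\<in>S. x \<odot> y \<in> S)"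

definition generates :: "'a set \<Rightarrow> bool" where
  "generates X \<longleftrightarrow> subalgebra hull X = UNIV"

definition finitely_generated :: bool where
  "finitely_generated \<longleftrightarrow> (\<exists>X. finite X \<and> generates X)"

text \<open>\<open>product_of X m x\<close>: some parenthesization of some word of length \<open>m \<ge> 1\<close> over \<open>X\<close>
  evaluates to \<open>x\<close>. Algebras need not have a unit, so there is no empty product.\<close>

inductive product_of :: "'a set \<Rightarrow> nat \<Rightarrow> 'a \<Rightarrow> bool" for X where
  generator: "x \<in> X \<Longrightarrow> product_of X 1 x"
| mult: "product_of X m x \<Longrightarrow> product_of X n y \<Longrightarrow> product_of X (m + n) (x \<odot> y)"

definition products_upto :: "'a set \<Rightarrow> nat \<Rightarrow> 'a set" where
  "products_upto X n = {x. \<exists>m\<le>n. product_of X m x}"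

definition growth :: "'a set \<Rightarrow> nat \<Rightarrow> nat" where
  "growth X n = dim (span (products_upto X n))"

end

locale jordan_algebra = nonassoc_algebra scale mul
  for scale :: "'k::field \<Rightarrow> 'a::ab_group_add \<Rightarrow> 'a"
    and mul :: "'a \<Rightarrow> 'a \<Rightarrow> 'a"  (infixl \<open>\<odot>\<close> 70) +
  assumes jordan_commute: "x \<odot> y = y \<odot> x"
    and jordan_identity: "(x \<odot> x) \<odot> (x \<odot> y) = x \<odot> ((x \<odot> x) \<odot> y)"

text \<open>Functions on the positive integers are represented by functions on \<^typ>\<open>nat\<close> whose value
  at \<open>0\<close> is ignored.\<close>

definition asymp_le :: "(nat \<Rightarrow> nat) \<Rightarrow> (nat \<Rightarrow> nat) \<Rightarrow> bool"  (infix \<open>\<preceq>\<close> 50) where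
  "f \<preceq> g \<longleftrightarrow> (\<exists>C::real. \<exists>D::nat. C > 0 \<and> D > 0 \<and> (\<forall>n\<ge>1. real (f n) \<le> C * real (g (D * n))))"

definition growth_equiv :: "(nat \<Rightarrow> nat) \<Rightarrow> (nat \<Rightarrow> nat) \<Rightarrow> bool"  (infix \<open>\<approx>\<close> 50) where
  "f \<approx> g \<longleftrightarrow> f \<preceq> g \<and> g \<preceq> f"

definition polynomially_bounded :: "(nat \<Rightarrow> nat) \<Rightarrow> bool" where
  "polynomially_bounded f \<longleftrightarrow>
     (\<exists>K::real. \<exists>d::real. K > 0 \<and> d > 0 \<and> (\<forall>n\<ge>1. real (f n) \<le> K * real n powr d))"

text \<open>The class of the growth function does not depend on the finite generating set, so an algebra
  has growth \<open>f\<close> when it is finitely generated and \<open>f\<close> is equivalent to its growth function for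
  whichever finite generating set is chosen.

  HOL cannot quantify existentially over types, so the algebra is sought on a fixed underlying
  group: the finitely supported functions \<^typ>\<open>nat \<Rightarrow>\<^sub>0 'k\<close>, with arbitrary scalar action and
  product. This loses nothing: a finitely generated algebra has countable dimension, and one whose
  growth dominates \<open>n\<^sup>2\<close> is infinite-dimensional, so up to isomorphism its underlying vector space
  is this one.\<close>

definition has_growth ::
  "('k::field \<Rightarrow> 'a::ab_group_add \<Rightarrow> 'a) \<Rightarrow> ('a \<Rightarrow> 'a \<Rightarrow> 'a) \<Rightarrow> (nat \<Rightarrow> nat) \<Rightarrow> bool" where
  "has_growth scale mul f \<longleftrightarrow>
     nonassoc_algebra.finitely_generated scale mul \<and>
     (\<forall>X. finite X \<and> nonassoc_algebra.generates scale mul X \<longrightarrow>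
        nonassoc_algebra.growth scale mul X \<approx> f)"

end

theory Submission
  imports Defs "HOL-Library.Countable_Set" "HOL-Library.Sublist"
begin

text \<open>If \<open>A\<close> is a monomial algebra, given by a factor-closed language \<open>L\<close>, then the Jordan algebra
  of 2 by 2 matrices over \<open>A\<close> with product \<open>xy + yx\<close> is finitely generated and grows like the
  number of words of \<open>L\<close>, so it suffices to find \<open>L\<close> with the required growth. Take the factors
  of words over a two-letter alphabet with \<open>r + 2\<close> runs, where at scale \<open>N = 2 ^ k\<close> the \<open>r\<close> inner
  runs have lengths in \<open>[N, 2N)\<close> and the two outer ones have length \<open>N\<close>. A factor of length at most
  \<open>N\<close> meets at most two runs, and the words with at most two runs have quadratic growth, which \<open>f\<close>
  dominates; hence the words of scale \<open>N\<close> matter only for lengths above \<open>N\<close>, where each of them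
  has between \<open>N\<^sup>2\<close> and a constant times \<open>N\<^sup>2\<close> factors. There are \<open>N ^ r\<close> choices of run lengths,
  enough for a polynomially bounded \<open>f\<close>, and using about \<open>(f(N) - f(N/2)) / N\<^sup>2\<close> of them makes the
  growth follow \<open>f\<close>.\<close>

subsection \<open>Comparing growth functions\<close>

lemma asymp_le_trans:
  assumes "f \<preceq> g" "g \<preceq> h"
  shows "f \<preceq> h"
proof -
  obtain C D where C: "C > 0" "D > 0" "\<forall>n\<ge>1. real (f n) \<le> C * real (g (D * n))"
    using assms(1) unfolding asymp_le_def by blast
  obtain C' D' where C': "C' > 0" "D' > 0" "\<forall>n\<ge>1. real (g n) \<le> C' * real (h (D' * n))"
    using assms(2) unfolding asymp_le_def by blast
  have "real (f n) \<le> (C * C') * real (h ((D' * D) * n))" if "n \<ge> 1" for n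
  proof -
    have "D * n \<ge> 1"
      using C(2) that by simp
    then have "real (g (D * n)) \<le> C' * real (h (D' * (D * n)))"
      using C'(3) by blast
    then have "C * real (g (D * n)) \<le> C * (C' * real (h (D' * (D * n))))"
      using C(1) by simp
    then show ?thesis
      using C(3) that by (force simp: mult.assoc)
  qed
  then show ?thesis
    unfolding asymp_le_def using C C' by (metis mult_pos_pos)
qed

lemma asymp_leI_nat:
  assumes "D > 0" "\<And>n. n \<ge> 1 \<Longrightarrow> f n \<le> C * g (D * n)"
  shows "f \<preceq> g"
proof -
  have "real (f n) \<le> real (Suc C) * real (g (D * n))" if "n \<ge> 1" for n
  proof -
    have "f n \<le> Suc C * g (D * n)"
      using assms(2)[OF that] by simp
    then show ?thesis
      by (metis of_nat_le_iff of_nat_mult)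
  qed
  then show ?thesis
    unfolding asymp_le_def using assms(1) by (metis of_nat_0_less_iff zero_less_Suc)
qed

context vector_space
begin

text \<open>A basis of \<open>span T\<close> chosen inside \<open>T\<close> is finite; for an
  infinite one \<open>card\<close> would return 0 and the comparison would fail.\<close>

lemma dim_le_dim_of_span:
  assumes "finite T" "S \<subseteq> span T"
  shows "dim S \<le> dim T"
proof -
  obtain B where B: "B \<subseteq> T" "independent B" "T \<subseteq> span B" "card B = dim T"
    using basis_exists by blast
  have "span T \<subseteq> span B"
    using B(3) by (simp add: span_minimal)
  then show ?thesis
    using dim_le_card[of S B] assms B finite_subset by fastforce
qed

end

section \<open>Spans of bounded products and independence of the generating set\<close>

context nonassoc_algebra
begin

lemma mult_zero_left [simp]: "0 \<odot> x = 0"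
  using mult_add_left[of 0 0 x] by simp

lemma mult_zero_right [simp]: "x \<odot> 0 = 0"
  using mult_add_right[of x 0 0] by simp

lemma product_of_pos: "product_of X m x \<Longrightarrow> m \<ge> 1"
  by (induction rule: product_of.induct) auto

lemma products_upto_mono: "m \<le> n \<Longrightarrow> products_upto X m \<subseteq> products_upto X n"
  unfolding products_upto_def using order_trans by blast

lemma mult_mem_products_upto:
  "x \<in> products_upto X m \<Longrightarrow> y \<in> products_upto X n \<Longrightarrow> x \<odot> y \<in> products_upto X (m + n)"
  unfolding products_upto_def using product_of.mult add_mono by fastforce

lemma generator_mem_products_upto: "x \<in> X \<Longrightarrow> n \<ge> 1 \<Longrightarrow> x \<in> products_upto X n"
  unfolding products_upto_def using product_of.generator by blast

lemma finite_products_upto: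
  assumes "finite X"
  shows "finite (products_upto X n)"
proof (induction n)
  case 0
  have "products_upto X 0 = {}"
    unfolding products_upto_def using product_of_pos by fastforce
  then show ?case by simp
next
  case (Suc n)
  have "products_upto X (Suc n) \<subseteq>
      X \<union> (\<lambda>(x, y). x \<odot> y) ` (products_upto X n \<times> products_upto X n)"
  proof
    fix x assume "x \<in> products_upto X (Suc n)"
    then obtain m where m: "m \<le> Suc n" "product_of X m x"
      by (auto simp: products_upto_def)
    from m(2) show "x \<in> X \<union> (\<lambda>(x, y). x \<odot> y) ` (products_upto X n \<times> products_upto X n)"
    proof cases
      case generator
      then show ?thesis by simp
    next
      case (mult k y l z)
      have "k \<ge> 1" "l \<ge> 1"
        using product_of_pos mult(3,4) by blast+
      then have "k \<le> n" "l \<le> n"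
        using m(1) mult(1) by linarith+
      then have "y \<in> products_upto X n" "z \<in> products_upto X n"
        using mult(3,4) by (auto simp: products_upto_def)
      then show ?thesis
        using mult(2) by force
    qed
  qed
  then show ?case
    using Suc assms by (auto intro: finite_subset)
qed

lemma mult_mem_span:
  assumes "x \<in> span A" "y \<in> span B" "\<And>u v. u \<in> A \<Longrightarrow> v \<in> B \<Longrightarrow> u \<odot> v \<in> span C"
  shows "x \<odot> y \<in> span C"
  using assms(1)
proof (induction rule: span_induct_alt)
  case base
  then show ?case by (simp add: span_zero)
next
  case (step c u v)
  have "u \<odot> y \<in> span C"
    using assms(2)
  proof (induction rule: span_induct_alt)
    case base
    then show ?case by (simp add: span_zero)
  next
    case (step d s t)
    then show ?case
      using assms(3)[OF \<open>u \<in> A\<close>] by (simp add: mult_add_right mult_scale_right span_add span_scale)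
  qed
  then show ?case
    using step by (simp add: mult_add_left mult_scale_left span_add span_scale)
qed

lemma mult_mem_span_products_upto:
  "x \<in> span (products_upto X m) \<Longrightarrow> y \<in> span (products_upto X n) \<Longrightarrow>
    x \<odot> y \<in> span (products_upto X (m + n))"
  using mult_mem_span mult_mem_products_upto span_base by blast

lemma span_products_upto_mono:
  "m \<le> n \<Longrightarrow> x \<in> span (products_upto X m) \<Longrightarrow> x \<in> span (products_upto X n)"
  using span_mono[OF products_upto_mono] by blast

text \<open>The spans increase with \<open>n\<close>, so their union is closed under sums; lengths
  add under multiplication, so it is closed under products too.\<close>

lemma subalgebra_hull_eq: "subalgebra hull X = (\<Union>n. span (products_upto X n))"
  (is "_ = ?U")
proof (rule hull_unique)
  show "X \<subseteq> ?U"
    using generator_mem_products_upto[of _ X 1] span_base by fastforce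
  have "subspace ?U"
  proof (rule subspaceI)
    show "0 \<in> ?U" by (simp add: span_zero)
    fix x y assume "x \<in> ?U" "y \<in> ?U"
    then obtain m n where "x \<in> span (products_upto X m)" "y \<in> span (products_upto X n)"
      by auto
    then have "x + y \<in> span (products_upto X (max m n))"
      by (meson max.cobounded1 max.cobounded2 span_add span_products_upto_mono)
    then show "x + y \<in> ?U" by auto
  qed (auto intro: span_scale)
  moreover have "x \<odot> y \<in> ?U" if "x \<in> ?U" "y \<in> ?U" for x y
    using that by (auto intro: mult_mem_span_products_upto)
  ultimately show "subalgebra ?U"
    by (simp only: subalgebra_def) blast
next
  fix S assume S: "X \<subseteq> S" "subalgebra S"
  have "x \<in> S" if "product_of X m x" for m x
    using that by (induction rule: product_of.induct) (use S in \<open>auto simp: subalgebra_def\<close>)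
  then have "products_upto X n \<subseteq> S" for n
    by (auto simp: products_upto_def)
  moreover have "subspace S"
    using S(2) by (simp add: subalgebra_def)
  ultimately have "span (products_upto X n) \<subseteq> S" for n
    by (rule span_minimal)
  then show "?U \<subseteq> S" by auto
qed

lemma subalgebra_subalgebra_hull: "subalgebra (subalgebra hull X)"
  by (rule hull_in) (auto simp: subalgebra_def subspace_def)

lemma generates_iff: "generates X \<longleftrightarrow> (\<forall>v. \<exists>n. v \<in> span (products_upto X n))"
  unfolding generates_def subalgebra_hull_eq by auto

lemma product_of_mem_span:
  assumes "product_of X m x" "X \<subseteq> span (products_upto Y D)"
  shows "x \<in> span (products_upto Y (D * m))"
  using assms(1)
proof (induction rule: product_of.induct)
  case (generator x)
  then show ?case using assms(2) by auto
next
  case (mult m x n y)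
  then show ?case
    using mult_mem_span_products_upto[of x Y "D * m" y "D * n"] by (simp add: algebra_simps)
qed

text \<open>One \<open>D\<close> serves all of the finite set \<open>X\<close>: its elements are
  combinations of products of at most \<open>D\<close> elements of \<open>Y\<close>, so length
  \<open>n\<close> over \<open>X\<close> costs at most \<open>D * n\<close> over
  \<open>Y\<close>.\<close>

lemma growth_asymp_le:
  assumes "finite X" "finite Y" "generates Y"
  shows "growth X \<preceq> growth Y"
proof -
  obtain d where d: "\<And>x. x \<in> span (products_upto Y (d x))"
    using assms(3) unfolding generates_iff by metis
  define D where "D = Suc (\<Sum>x\<in>X. d x)"
  have "d x \<le> D" if "x \<in> X" for x
    unfolding D_def using member_le_sum[of x X d] that assms(1) by simp
  then have X: "X \<subseteq> span (products_upto Y D)"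
    using d span_products_upto_mono by blast
  have "products_upto X n \<subseteq> span (products_upto Y (D * n))" for n
  proof
    fix x assume "x \<in> products_upto X n"
    then obtain m where m: "m \<le> n" "product_of X m x"
      unfolding products_upto_def by blast
    then have "x \<in> span (products_upto Y (D * m))"
      using product_of_mem_span X by blast
    then show "x \<in> span (products_upto Y (D * n))"
      using m(1) span_products_upto_mono[of "D * m" "D * n"] by simp
  qed
  then have "growth X n \<le> growth Y (D * n)" for n
    unfolding growth_def using dim_le_dim_of_span[OF finite_products_upto[OF assms(2)]] by simp
  then show ?thesis
    using asymp_leI_nat[of D "growth X" 1 "growth Y"] by (simp add: D_def)
qed

text \<open>Finite generating sets bound each other by \<open>growth_asymp_le\<close>, so testing
  one is enough.\<close>

lemma has_growthI:
  assumes "finite X" "generates X" "growth X \<approx> f"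
  shows "has_growth scale (\<odot>) f"
  unfolding has_growth_def finitely_generated_def growth_equiv_def
  using assms growth_asymp_le asymp_le_trans unfolding growth_equiv_def by meson

end

subsection \<open>Contracted algebras of partial semigroups\<close>

definition pm_scale :: "'k::field \<Rightarrow> ('s \<Rightarrow>\<^sub>0 'k) \<Rightarrow> ('s \<Rightarrow>\<^sub>0 'k)" where
  "pm_scale c = Poly_Mapping.map ((*) c)"

lemma lookup_pm_scale [simp]: "Poly_Mapping.lookup (pm_scale c a) i = c * Poly_Mapping.lookup a i"
  unfolding pm_scale_def by (simp add: map.rep_eq when_def)

interpretation pm: vector_space pm_scale
  by unfold_locales (auto intro!: poly_mapping_eqI simp: lookup_add algebra_simps)

abbreviation pm_basis :: "'s \<Rightarrow> ('s \<Rightarrow>\<^sub>0 'k::field)" where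
  "pm_basis i \<equiv> Poly_Mapping.single i 1"

text \<open>Reduces an identity linear in a variable to basis vectors; used once per variable, it
  treats multilinear identities.\<close>

lemma pm_induct [case_names zero basis add scale]:
  assumes "P 0" "\<And>i. P (pm_basis i)" "\<And>a b. P a \<Longrightarrow> P b \<Longrightarrow> P (a + b)"
    "\<And>c a. P a \<Longrightarrow> P (pm_scale c a)"
  shows "P a"
proof (induction a rule: update_induct)
  case const
  show ?case by fact
next
  case (update f i b)
  have "Poly_Mapping.update i b f = f + pm_scale b (pm_basis i)"
    using update(1) by (intro poly_mapping_eqI)
      (auto simp: lookup_update lookup_add lookup_single when_def in_keys_iff)
  then show ?case using assms update by simp
qed

lemma independent_pm_basis: "pm.independent (pm_basis ` A :: ('a \<Rightarrow>\<^sub>0 'b::field) set)"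
proof
  assume "pm.dependent (pm_basis ` A :: ('a \<Rightarrow>\<^sub>0 'b) set)"
  then obtain i where i: "(pm_basis i :: 'a \<Rightarrow>\<^sub>0 'b) \<in> pm.span (pm_basis ` A - {pm_basis i})"
    unfolding pm.dependent_def by blast
  have "pm.subspace {p :: 'a \<Rightarrow>\<^sub>0 'b. Poly_Mapping.lookup p i = 0}"
    by (rule pm.subspaceI) (auto simp: lookup_add)
  moreover have "pm_basis ` A - {pm_basis i} \<subseteq> {p :: 'a \<Rightarrow>\<^sub>0 'b. Poly_Mapping.lookup p i = 0}"
    by (auto simp: lookup_single when_def)
  ultimately have "(pm_basis i :: 'a \<Rightarrow>\<^sub>0 'b) \<in> {p. Poly_Mapping.lookup p i = 0}"
    using i pm.span_minimal by blast
  then show False by simp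
qed

definition lin_ext :: "('s \<Rightarrow> ('t \<Rightarrow>\<^sub>0 'k)) \<Rightarrow> ('s \<Rightarrow>\<^sub>0 'k) \<Rightarrow> ('t \<Rightarrow>\<^sub>0 'k::field)" where
  "lin_ext f a = (\<Sum>i\<in>Poly_Mapping.keys a. pm_scale (Poly_Mapping.lookup a i) (f i))"

text \<open>Cancellation can shrink the keys of \<open>a + b\<close>, so sums are compared over a
  common larger index set.\<close>

lemma lin_ext_superset:
  assumes "finite A" "Poly_Mapping.keys a \<subseteq> A"
  shows "lin_ext f a = (\<Sum>i\<in>A. pm_scale (Poly_Mapping.lookup a i) (f i))"
  unfolding lin_ext_def
  by (rule sum.mono_neutral_left) (use assms in \<open>auto simp: in_keys_iff\<close>)

lemma lin_ext_basis [simp]: "lin_ext f (pm_basis i) = f i"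
  unfolding lin_ext_def by simp

lemma lin_ext_zero [simp]: "lin_ext f 0 = 0"
  unfolding lin_ext_def by simp

lemma lin_ext_add: "lin_ext f (a + b) = lin_ext f a + lin_ext f b"
proof -
  let ?A = "Poly_Mapping.keys a \<union> Poly_Mapping.keys b"
  have "lin_ext f x = (\<Sum>i\<in>?A. pm_scale (Poly_Mapping.lookup x i) (f i))"
    if "x \<in> {a, b, a + b}" for x
    using that keys_add[of a b] by (intro lin_ext_superset) auto
  then show ?thesis
    by (simp add: lookup_add pm.scale_left_distrib sum.distrib)
qed

lemma lin_ext_scale: "lin_ext f (pm_scale c a) = pm_scale c (lin_ext f a)"
proof -
  have "Poly_Mapping.keys (pm_scale c a) \<subseteq> Poly_Mapping.keys a"
    by (auto simp: in_keys_iff)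
  then have "lin_ext f (pm_scale c a) = (\<Sum>i\<in>Poly_Mapping.keys a. pm_scale (Poly_Mapping.lookup (pm_scale c a) i) (f i))"
    by (intro lin_ext_superset) auto
  then show ?thesis
    by (simp add: lin_ext_def pm.scale_sum_right)
qed

lemma lin_ext_fun_add: "lin_ext (\<lambda>i. f i + g i) a = lin_ext f a + lin_ext g a"
  unfolding lin_ext_def by (simp add: pm.scale_right_distrib sum.distrib)

lemma lin_ext_fun_scale: "lin_ext (\<lambda>i. pm_scale c (f i)) a = pm_scale c (lin_ext f a)"
  unfolding lin_ext_def by (simp add: pm.scale_sum_right mult.commute)

lemma lin_ext_fun_zero [simp]: "lin_ext (\<lambda>i. 0) a = 0"
  unfolding lin_ext_def by simp

lemmas lin_ext_simps = lin_ext_add lin_ext_scale lin_ext_fun_add lin_ext_fun_scale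

text \<open>\<open>None\<close> acts as a zero: the two bracketings must be undefined together or
  agree. In the algebra below, undefined products become 0.\<close>

locale partial_semigroup =
  fixes op :: "'s \<Rightarrow> 's \<Rightarrow> 's option"
  assumes op_assoc: "Option.bind (op i j) (\<lambda>m. op m k) = Option.bind (op j k) (\<lambda>m. op i m)"
begin

definition basis_mul :: "'s \<Rightarrow> 's \<Rightarrow> ('s \<Rightarrow>\<^sub>0 'k::field)" where
  "basis_mul i j = (case op i j of None \<Rightarrow> 0 | Some m \<Rightarrow> pm_basis m)"

definition alg_mul :: "('s \<Rightarrow>\<^sub>0 'k) \<Rightarrow> ('s \<Rightarrow>\<^sub>0 'k) \<Rightarrow> ('s \<Rightarrow>\<^sub>0 'k::field)" (infixl \<open>\<star>\<close> 70) where
  "a \<star> b = lin_ext (\<lambda>i. lin_ext (basis_mul i) b) a"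

lemma alg_mul_simps:
  "(a + b) \<star> c = a \<star> c + b \<star> c" "a \<star> (b + c) = a \<star> b + a \<star> c"
  "pm_scale r a \<star> b = pm_scale r (a \<star> b)" "a \<star> pm_scale r b = pm_scale r (a \<star> b)"
  "0 \<star> a = 0" "a \<star> 0 = 0"
  unfolding alg_mul_def by (simp_all add: lin_ext_simps)

lemma alg_mul_basis: "pm_basis i \<star> pm_basis j = basis_mul i j"
  unfolding alg_mul_def by simp

lemma basis_mul_assoc: "basis_mul i j \<star> pm_basis k = pm_basis i \<star> (basis_mul j k :: 's \<Rightarrow>\<^sub>0 'k::field)"
proof -
  have "basis_mul i j \<star> (pm_basis k :: 's \<Rightarrow>\<^sub>0 'k) =
      (case Option.bind (op i j) (\<lambda>m. op m k) of None \<Rightarrow> 0 | Some m \<Rightarrow> pm_basis m)"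
    unfolding basis_mul_def[of i j]
    by (cases "op i j") (simp_all add: alg_mul_basis alg_mul_simps basis_mul_def)
  moreover have "pm_basis i \<star> (basis_mul j k :: 's \<Rightarrow>\<^sub>0 'k) =
      (case Option.bind (op j k) (\<lambda>m. op i m) of None \<Rightarrow> 0 | Some m \<Rightarrow> pm_basis m)"
    unfolding basis_mul_def[of j k]
    by (cases "op j k") (simp_all add: alg_mul_basis alg_mul_simps basis_mul_def)
  ultimately show ?thesis by (simp add: op_assoc)
qed

lemma alg_mul_assoc: "(a \<star> b) \<star> c = a \<star> (b \<star> c)"
proof (induction a rule: pm_induct)
  case (basis i)
  show ?case
  proof (induction b rule: pm_induct)
    case (basis j)
    show ?case
      by (induction c rule: pm_induct) (simp_all add: alg_mul_simps alg_mul_basis basis_mul_assoc)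
  qed (simp_all add: alg_mul_simps)
qed (simp_all add: alg_mul_simps)

text \<open>Omitting the customary factor \<open>1/2\<close> rescales the Jordan product, which does not affect the
  Jordan identity.\<close>

definition jordan_mul :: "('s \<Rightarrow>\<^sub>0 'k) \<Rightarrow> ('s \<Rightarrow>\<^sub>0 'k) \<Rightarrow> ('s \<Rightarrow>\<^sub>0 'k::field)" (infixl \<open>\<bullet>\<close> 70) where
  "a \<bullet> b = a \<star> b + b \<star> a"

text \<open>Once expanded, both sides of the Jordan identity are the same sum of associative
  monomials.\<close>

lemma jordan_algebra_jordan_mul: "jordan_algebra pm_scale jordan_mul"
  by unfold_locales (simp_all add: jordan_mul_def alg_mul_simps pm.scale_right_distrib
      alg_mul_assoc add_ac)

end

subsection \<open>The Jordan algebra of a factorial language\<close>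

lemma two_neq_zero_of_CHAR:
  assumes "CHAR('k::field) \<noteq> 2"
  shows "(2 :: 'k) \<noteq> 0"
proof
  assume "(2 :: 'k) = 0"
  then have "CHAR('k) dvd 2"
    by (metis of_nat_eq_0_iff_char_dvd of_nat_numeral)
  then have "CHAR('k) \<in> {1, 2}"
    using dvd_imp_le[of "CHAR('k)" 2] by (cases "CHAR('k)") auto
  then show False
    using assms CHAR_not_1'[where 'a = 'k] by simp
qed

definition words_upto :: "'c list set \<Rightarrow> nat \<Rightarrow> 'c list set" where
  "words_upto L n = {w \<in> L. length w \<le> n}"

lemma finite_words_upto: "finite (words_upto (L :: 'c::finite list set) n)"
proof -
  have "words_upto L n \<subseteq> {w. set w \<subseteq> UNIV \<and> length w \<le> n}"
    by (auto simp: words_upto_def)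
  then show ?thesis
    by (rule finite_subset) (rule finite_lists_length_le, simp)
qed

text \<open>The elements \<open>(i, w, j)\<close> with \<open>w \<in> L\<close> are the matrix units \<open>w e\<^sub>i\<^sub>j\<close> of the algebra of
  2 by 2 matrices over the monomial algebra of \<open>L\<close>. Passing to matrices makes the Jordan product
  recover concatenation.\<close>

locale factorial_language =
  fixes L :: "'c::finite list set"
  assumes factor_closed: "u @ v \<in> L \<Longrightarrow> u \<in> L \<and> v \<in> L"
    and infinite_language: "infinite L"
begin

definition units :: "(bool \<times> 'c list \<times> bool) set" where
  "units = UNIV \<times> L \<times> UNIV"

definition unit_mul ::
  "bool \<times> 'c list \<times> bool \<Rightarrow> bool \<times> 'c list \<times> bool \<Rightarrow> (bool \<times> 'c list \<times> bool) option" where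
  "unit_mul s t = (case (s, t) of ((i, u, j), (k, v, l)) \<Rightarrow>
     if j = k \<and> u @ v \<in> L then Some (i, u @ v, l) else None)"

abbreviation dec :: "nat \<Rightarrow> bool \<times> 'c list \<times> bool" where
  "dec \<equiv> from_nat_into units"

abbreviation enc :: "bool \<times> 'c list \<times> bool \<Rightarrow> nat" where
  "enc \<equiv> to_nat_on units"

text \<open>Infinitude makes \<open>enc\<close> and \<open>dec\<close> inverse bijections between
  the units and the naturals, which puts the algebra on
  \<open>nat \<Rightarrow>\<^sub>0 'k\<close>.\<close>

lemma infinite_units: "infinite units"
  unfolding units_def using infinite_language
  by (metis Times_empty UNIV_not_empty finite_cartesian_productD1 finite_cartesian_productD2)

lemma units_nonempty: "units \<noteq> {}"
  using infinite_units by auto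

lemma countable_units: "countable units"
  by simp

lemma dec_mem: "dec n \<in> units"
  using units_nonempty by (rule from_nat_into)

lemma dec_enc [simp]: "s \<in> units \<Longrightarrow> dec (enc s) = s"
  using countable_units by simp

lemma enc_dec [simp]: "enc (dec n) = n"
  using infinite_units countable_units by (simp add: to_nat_on_from_nat_into_infinite)

definition index_mul :: "nat \<Rightarrow> nat \<Rightarrow> nat option" where
  "index_mul m n = map_option enc (unit_mul (dec m) (dec n))"

lemma unit_mul_mem: "unit_mul s t = Some r \<Longrightarrow> r \<in> units"
  by (auto simp: unit_mul_def units_def split: prod.splits if_splits)

text \<open>If \<open>u @ v @ w\<close> lies in \<open>L\<close>, factor closure puts
  \<open>u @ v\<close> and \<open>v @ w\<close> there too, so neither bracketing is undefined
  alone.\<close>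

lemma unit_mul_assoc:
  "Option.bind (unit_mul r s) (\<lambda>m. unit_mul m t) = Option.bind (unit_mul s t) (\<lambda>m. unit_mul r m)"
proof -
  obtain i u j k v l p w q where rst: "r = (i, u, j)" "s = (k, v, l)" "t = (p, w, q)"
    by (metis prod_cases3)
  have "u @ v @ w \<in> L \<Longrightarrow> u @ v \<in> L \<and> v @ w \<in> L"
    using factor_closed[of "u @ v" w] factor_closed[of u "v @ w"] by simp
  then show ?thesis
    by (auto simp: unit_mul_def rst)
qed

lemma index_mul_bind_left:
  "Option.bind (index_mul i j) (\<lambda>m. index_mul m k) =
    map_option enc (Option.bind (unit_mul (dec i) (dec j)) (\<lambda>m. unit_mul m (dec k)))"
  by (cases "unit_mul (dec i) (dec j)") (auto simp: index_mul_def dest: unit_mul_mem)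

lemma index_mul_bind_right:
  "Option.bind (index_mul j k) (\<lambda>m. index_mul i m) =
    map_option enc (Option.bind (unit_mul (dec j) (dec k)) (\<lambda>m. unit_mul (dec i) m))"
  by (cases "unit_mul (dec j) (dec k)") (auto simp: index_mul_def dest: unit_mul_mem)

sublocale partial_semigroup index_mul
  by unfold_locales (simp only: index_mul_bind_left index_mul_bind_right unit_mul_assoc)

notation alg_mul (infixl \<open>\<star>\<close> 70)
notation jordan_mul (infixl \<open>\<bullet>\<close> 70)

text \<open>Words outside \<open>L\<close> get the vector 0, as in the monomial algebra, so a
  concatenation need not be tested for membership.\<close>

definition unit_vec :: "bool \<Rightarrow> 'c list \<Rightarrow> bool \<Rightarrow> (nat \<Rightarrow>\<^sub>0 'k::field)" where
  "unit_vec i w j = (if w \<in> L then pm_basis (enc (i, w, j)) else 0)"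

lemma unit_vec_alg_mul:
  assumes "u \<in> L" "v \<in> L"
  shows "unit_vec i u j \<star> unit_vec k v l = (if j = k then unit_vec i (u @ v) l else 0)"
proof -
  have "(i, u, j) \<in> units" "(k, v, l) \<in> units"
    using assms by (auto simp: units_def)
  then show ?thesis
    using assms by (auto simp: unit_vec_def alg_mul_basis basis_mul_def index_mul_def unit_mul_def)
qed

lemma unit_vec_jordan_mul:
  assumes "u \<in> L" "v \<in> L"
  shows "unit_vec i u j \<bullet> unit_vec k v l =
    (if j = k then unit_vec i (u @ v) l else 0) + (if l = i then unit_vec k (v @ u) j else 0)"
  using assms by (simp add: jordan_mul_def unit_vec_alg_mul)

lemma pm_basis_eq_unit_vec: "\<exists>i w j. w \<in> L \<and> (pm_basis n :: nat \<Rightarrow>\<^sub>0 'k::field) = unit_vec i w j"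
proof -
  obtain i w j where "dec n = (i, w, j)"
    by (metis prod_cases3)
  then have "w \<in> L" "enc (i, w, j) = n"
    using dec_mem[of n] enc_dec[of n] by (auto simp: units_def)
  then have "w \<in> L \<and> pm_basis n = (unit_vec i w j :: nat \<Rightarrow>\<^sub>0 'k)"
    by (auto simp: unit_vec_def)
  then show ?thesis by blast
qed

text \<open>\<open>unit_vecs 1\<close> will be the generating set; it includes the units of the
  empty word.\<close>

definition unit_vecs :: "nat \<Rightarrow> (nat \<Rightarrow>\<^sub>0 'k::field) set" where
  "unit_vecs n = pm_basis ` enc ` (UNIV \<times> words_upto L n \<times> UNIV)"

lemma unit_vecs_eq: "unit_vecs n = {unit_vec i w j | i w j. w \<in> words_upto L n}"
  by (force simp: unit_vecs_def unit_vec_def words_upto_def)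

lemma unit_vec_mem_unit_vecs: "w \<in> L \<Longrightarrow> length w \<le> n \<Longrightarrow> unit_vec i w j \<in> unit_vecs n"
  unfolding unit_vecs_eq words_upto_def by blast

lemma finite_unit_vecs: "finite (unit_vecs n)"
  unfolding unit_vecs_def by (simp add: finite_words_upto)

lemma card_unit_vecs: "card (unit_vecs n :: (nat \<Rightarrow>\<^sub>0 'k::field) set) = 4 * card (words_upto L n)"
proof -
  have "inj_on enc (UNIV \<times> words_upto L n \<times> UNIV)"
    using countable_units
    by (rule inj_on_subset[OF inj_on_to_nat_on]) (auto simp: units_def words_upto_def)
  moreover have "inj (pm_basis :: nat \<Rightarrow> nat \<Rightarrow>\<^sub>0 'k)"
    by (rule injI) (metis keys_single one_neq_zero singleton_inject)
  ultimately show ?thesis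
    unfolding unit_vecs_def
    by (simp add: card_image inj_on_subset[OF _ subset_UNIV] card_cartesian_product)
qed

section \<open>Growth of the Jordan algebra of the language\<close>

context
  fixes field_type :: "'k::field itself"
begin

interpretation J: jordan_algebra pm_scale "jordan_mul :: (nat \<Rightarrow>\<^sub>0 'k) \<Rightarrow> _"
  by (rule jordan_algebra_jordan_mul)

text \<open>A product of two matrix units has at most two terms, whose words concatenate those of
  the factors, so word length never exceeds the number of generators used.\<close>

lemma product_of_unit_vecs:
  "J.product_of (unit_vecs 1) n x \<Longrightarrow> x \<in> pm.span (unit_vecs n :: (nat \<Rightarrow>\<^sub>0 'k) set)"
proof (induction rule: J.product_of.induct)
  case (generator x)
  then show ?case by (rule pm.span_base)
next
  case (mult m x n y)
  show ?case
  proof (rule J.mult_mem_span[OF mult.IH])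
    fix a b :: "nat \<Rightarrow>\<^sub>0 'k" assume "a \<in> unit_vecs m" "b \<in> unit_vecs n"
    then obtain i u j k v l where ab: "a = unit_vec i u j" "b = unit_vec k v l"
      "u \<in> words_upto L m" "v \<in> words_upto L n"
      unfolding unit_vecs_eq by blast
    have *: "unit_vec p w q \<in> pm.span (unit_vecs (m + n) :: (nat \<Rightarrow>\<^sub>0 'k) set)"
      if "length w \<le> m + n" for p w q
    proof (cases "w \<in> L")
      case True
      then show ?thesis
        using that by (intro pm.span_base unit_vec_mem_unit_vecs)
    qed (simp add: unit_vec_def pm.span_zero)
    have "u \<in> L" "v \<in> L" "length u \<le> m" "length v \<le> n"
      using ab by (auto simp: words_upto_def)
    then show "a \<bullet> b \<in> pm.span (unit_vecs (m + n))"
      unfolding ab by (auto simp: unit_vec_jordan_mul intro!: pm.span_add * pm.span_zero)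
  qed
qed

lemma Nil_mem_language: "[] \<in> L"
  using infinite_language factor_closed[of "[]"] by (metis append_Nil ex_in_conv finite.emptyI)

text \<open>Prepending a letter costs at most two factors. Off the diagonal, one product with the
  letter is the concatenation. On the diagonal, a detour over the other index adds a second term,
  which the idempotent of the empty word removes; it doubles the wanted term, hence the division by
  2.\<close>

lemma unit_vec_mem_span_products_upto:
  assumes "(2 :: 'k) \<noteq> 0"
  shows "w \<in> L \<Longrightarrow>
    (unit_vec i w j :: nat \<Rightarrow>\<^sub>0 'k) \<in> pm.span (J.products_upto (unit_vecs 1) (2 * length w + 1))"
proof (induction w arbitrary: i j)
  case Nil
  then have "(unit_vec i [] j :: nat \<Rightarrow>\<^sub>0 'k) \<in> unit_vecs 1"
    by (simp add: unit_vec_mem_unit_vecs)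
  then show ?case
    by (simp add: J.generator_mem_products_upto pm.span_base)
next
  case (Cons a w)
  let ?P = "\<lambda>n. pm.span (J.products_upto (unit_vecs 1 :: (nat \<Rightarrow>\<^sub>0 'k) set) n)"
  have aw: "[a] \<in> L" "w \<in> L"
    using factor_closed[of "[a]" w] Cons.prems by auto
  have gen: "unit_vec p v q \<in> ?P 1" if "v \<in> L" "length v \<le> 1" for p v q
    using that by (intro pm.span_base J.generator_mem_products_upto unit_vec_mem_unit_vecs) simp_all
  have prod: "unit_vec i [a] k \<bullet> unit_vec k w j \<in> ?P (2 * length w + 2)" for k
    using J.mult_mem_span_products_upto[OF gen[OF aw(1)] Cons.IH[OF aw(2)]] by simp
  show ?case
  proof (cases "i = j")
    case False
    have "unit_vec i [a] i \<bullet> unit_vec i w j = (unit_vec i (a # w) j :: nat \<Rightarrow>\<^sub>0 'k)"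
      using aw False by (simp add: unit_vec_jordan_mul)
    then have "unit_vec i (a # w) j \<in> ?P (2 * length w + 2)"
      using prod[of i] by simp
    then show ?thesis
      by (rule J.span_products_upto_mono[rotated]) simp
  next
    case True
    \<comment> \<open>The detour yields \<open>a # w\<close> at index \<open>i\<close> and the
      rotated word \<open>w @ [a]\<close> at the other diagonal entry.\<close>
    define z :: "nat \<Rightarrow>\<^sub>0 'k" where "z = unit_vec i [a] (\<not> i) \<bullet> unit_vec (\<not> i) w j"
    have z: "z = unit_vec i (a # w) i + unit_vec (\<not> i) (w @ [a]) (\<not> i)"
      using aw True by (simp add: z_def unit_vec_jordan_mul)
    \<comment> \<open>The rotated word need not lie in \<open>L\<close>; then its vector is
      0.\<close>
    have "unit_vec i [] i \<bullet> unit_vec (\<not> i) (w @ [a]) (\<not> i) = (0 :: nat \<Rightarrow>\<^sub>0 'k)"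
    proof (cases "w @ [a] \<in> L")
      case True
      then show ?thesis by (simp add: unit_vec_jordan_mul Nil_mem_language)
    next
      case False
      then show ?thesis by (simp add: unit_vec_def)
    qed
    then have "unit_vec i [] i \<bullet> z = unit_vec i (a # w) i + unit_vec i (a # w) i"
      unfolding z J.mult_add_right
      using unit_vec_jordan_mul[OF Nil_mem_language Cons.prems, of i i i i] by simp
    also have "\<dots> = pm_scale 2 (unit_vec i (a # w) i)"
      by (metis one_add_one pm.scale_left_distrib pm.scale_one)
    finally have half: "pm_scale (1 / 2) (unit_vec i [] i \<bullet> z) = unit_vec i (a # w) i"
      using assms by simp
    have "z \<in> ?P (2 * length w + 2)"
      unfolding z_def by (rule prod[of "\<not> i"])
    then have "unit_vec i [] i \<bullet> z \<in> ?P (1 + (2 * length w + 2))"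
      by (intro J.mult_mem_span_products_upto gen Nil_mem_language) simp_all
    then have "pm_scale (1 / 2) (unit_vec i [] i \<bullet> z) \<in> ?P (1 + (2 * length w + 2))"
      by (rule pm.span_scale)
    then show ?thesis
      unfolding half using True by simp
  qed
qed

lemma has_growth_language:
  fixes f :: "nat \<Rightarrow> nat"
  assumes "CHAR('k) \<noteq> 2" "(\<lambda>n. card (words_upto L n)) \<approx> f"
  shows "has_growth pm_scale (jordan_mul :: (nat \<Rightarrow>\<^sub>0 'k) \<Rightarrow> _) f"
proof (rule J.has_growthI)
  let ?X = "unit_vecs 1 :: (nat \<Rightarrow>\<^sub>0 'k) set"
  note mem_span = unit_vec_mem_span_products_upto[OF two_neq_zero_of_CHAR[OF assms(1)]]
  show "finite ?X" by (rule finite_unit_vecs)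
  have sub: "pm.subspace (J.subalgebra hull ?X)"
    using J.subalgebra_subalgebra_hull by (simp add: J.subalgebra_def)
  have "v \<in> J.subalgebra hull ?X" for v
  proof (induction v rule: pm_induct)
    case (basis n)
    obtain i w j where "w \<in> L" "(pm_basis n :: nat \<Rightarrow>\<^sub>0 'k) = unit_vec i w j"
      using pm_basis_eq_unit_vec by blast
    then show ?case
      unfolding J.subalgebra_hull_eq using mem_span by auto
  qed (use sub in \<open>auto simp: pm.subspace_def\<close>)
  then show "J.generates ?X"
    unfolding J.generates_def by blast
  have "J.growth ?X n \<le> 4 * card (words_upto L n)" for n
  proof -
    have "J.products_upto ?X n \<subseteq> pm.span (unit_vecs n)"
    proof
      fix x assume "x \<in> J.products_upto ?X n"
      then obtain m where m: "m \<le> n" "J.product_of ?X m x"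
        by (auto simp: J.products_upto_def)
      have "unit_vecs m \<subseteq> (unit_vecs n :: (nat \<Rightarrow>\<^sub>0 'k) set)"
        unfolding unit_vecs_def words_upto_def using m(1) by (intro image_mono) auto
      then show "x \<in> pm.span (unit_vecs n)"
        using pm.span_mono product_of_unit_vecs[OF m(2)] by blast
    qed
    then have "J.growth ?X n \<le> card (unit_vecs n :: (nat \<Rightarrow>\<^sub>0 'k) set)"
      unfolding J.growth_def pm.dim_span by (intro pm.dim_le_card finite_unit_vecs)
    then show ?thesis
      by (simp add: card_unit_vecs)
  qed
  then have upper: "J.growth ?X \<preceq> (\<lambda>n. card (words_upto L n))"
    by (intro asymp_leI_nat[of 1 _ 4]) simp_all
  \<comment> \<open>For \<open>length w \<le> n\<close> and \<open>n \<ge> 1\<close>, the cost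
    \<open>2 * length w + 1\<close> is at most \<open>3 * n\<close>.\<close>
  have "card (words_upto L n) \<le> J.growth ?X (3 * n)" if "n \<ge> 1" for n
  proof -
    have "unit_vecs n \<subseteq> pm.span (J.products_upto ?X (3 * n))"
    proof
      fix x :: "nat \<Rightarrow>\<^sub>0 'k" assume "x \<in> unit_vecs n"
      then obtain i w j where x: "x = unit_vec i w j" "w \<in> L" "length w \<le> n"
        by (auto simp: unit_vecs_eq words_upto_def)
      show "x \<in> pm.span (J.products_upto ?X (3 * n))"
        unfolding x(1) by (rule J.span_products_upto_mono[OF _ mem_span[OF x(2)]]) (use x(3) that in simp)
    qed
    then have "pm.dim (unit_vecs n :: (nat \<Rightarrow>\<^sub>0 'k) set) \<le> pm.dim (J.products_upto ?X (3 * n))"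
      by (intro pm.dim_le_dim_of_span J.finite_products_upto finite_unit_vecs)
    moreover have "pm.dim (unit_vecs n :: (nat \<Rightarrow>\<^sub>0 'k) set) = card (unit_vecs n :: (nat \<Rightarrow>\<^sub>0 'k) set)"
      unfolding unit_vecs_def using independent_pm_basis by (rule pm.dim_eq_card_independent)
    ultimately show ?thesis
      by (simp add: J.growth_def card_unit_vecs)
  qed
  then have lower: "(\<lambda>n. card (words_upto L n)) \<preceq> J.growth ?X"
    by (intro asymp_leI_nat[of 3 _ 1]) simp_all
  show "J.growth ?X \<approx> f"
    using upper lower assms(2) asymp_le_trans unfolding growth_equiv_def by blast
qed

end

end

subsection \<open>Words with long runs\<close>

fun runs :: "bool \<Rightarrow> nat list \<Rightarrow> bool list" where
  "runs b [] = []"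
| "runs b (n # ns) = replicate n b @ runs (\<not> b) ns"

lemma length_runs: "length (runs b ns) = sum_list ns"
  by (induction ns arbitrary: b) auto

lemma runs_append:
  "runs b (ns @ ms) = runs b ns @ runs (if even (length ns) then b else \<not> b) ms"
  by (induction ns arbitrary: b) auto

lemma takeWhile_runs:
  "0 \<notin> set ns \<Longrightarrow> takeWhile ((=) b) (runs b (n # ns)) = replicate n b"
  by (cases ns) (auto simp: gr0_conv_Suc intro: trans[OF takeWhile_append2])

text \<open>With positive lengths the first run is the longest constant prefix and can be read off;
  an inner run of length 0 would merge its neighbours.\<close>

lemma runs_inject:
  "0 \<notin> set ns \<Longrightarrow> 0 \<notin> set ms \<Longrightarrow> runs b ns = runs b ms \<Longrightarrow> ns = ms"
proof (induction ns arbitrary: b ms)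
  case Nil
  then show ?case by (cases ms) auto
next
  case (Cons n ns)
  then obtain m ms' where ms: "ms = m # ms'"
    by (cases ms) auto
  have "replicate n b = replicate m b"
    using takeWhile_runs[of ns b n] takeWhile_runs[of ms' b m] Cons.prems ms by auto
  then have "n = m"
    by (metis length_replicate)
  then show ?case
    using Cons.IH[of ms' "\<not> b"] Cons.prems ms by auto
qed

lemma sublist_runs_ends:
  assumes "p \<le> N" "q \<le> N"
  shows "sublist (runs b (p # ns @ [q])) (runs b (N # ns @ [N]))"
proof -
  define c where "c = (if even (length ns) then \<not> b else b)"
  have *: "runs b (x # ns @ [y]) = replicate x b @ runs (\<not> b) ns @ replicate y c" for x y
    by (simp add: runs_append c_def)
  have "replicate N b = replicate (N - p) b @ replicate p b"
    "replicate N c = replicate q c @ replicate (N - q) c"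
    using assms by (simp_all flip: replicate_add)
  then have "runs b (N # ns @ [N]) =
      replicate (N - p) b @ runs b (p # ns @ [q]) @ replicate (N - q) c"
    unfolding * by simp
  then show ?thesis
    using sublist_appendI by metis
qed

text \<open>Either exponent may be 0, so constant words and the empty word are included.\<close>

definition two_run_words :: "bool list set" where
  "two_run_words = {replicate i b @ replicate j (\<not> b) | i j b. True}"

text \<open>A word crossing the end of the first run reaches at most \<open>N\<close> letters beyond
  it, all inside the next run. Otherwise it lies in the first run or in the rest, where induction
  applies.\<close>

lemma short_sublist_runs:
  assumes "sublist w (runs b ns)" "\<forall>n\<in>set ns. N \<le> n" "length w \<le> N"
  shows "w \<in> two_run_words"
  using assms
proof (induction ns arbitrary: b)
  case Nil
  then show ?case
    by (auto simp: two_run_words_def intro!: exI[of _ 0])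
next
  case (Cons n ns)
  consider "sublist w (replicate n b)" | "sublist w (runs (\<not> b) ns)"
    | u v where "w = u @ v" "suffix u (replicate n b)" "prefix v (runs (\<not> b) ns)"
    using Cons.prems(1) by (auto simp: sublist_append)
  then show ?case
  proof cases
    case 1
    then have "set w \<subseteq> {b}"
      using set_mono_sublist by fastforce
    then have "w = replicate (length w) b @ replicate 0 (\<not> b)"
      by (simp add: replicate_eqI subset_iff)
    then show ?thesis
      unfolding two_run_words_def by blast
  next
    case 2
    then show ?thesis using Cons by auto
  next
    case 3
    have "set u \<subseteq> {b}"
      using set_mono_suffix[OF 3(2)] by auto
    then have u: "u = replicate (length u) b"
      by (metis replicate_eqI singletonD subsetD)
    have "set v \<subseteq> {\<not> b}"
    proof (cases ns)
      case Nil
      then show ?thesis using 3(3) by simp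
    next
      case (Cons m ms)
      then have "length v \<le> m"
        using Cons.prems(2,3) 3(1) by simp
      then have "prefix v (replicate m (\<not> b))"
        using 3(3) Cons by (auto simp: prefix_append)
      then show ?thesis
        using set_mono_prefix by fastforce
    qed
    then have "v = replicate (length v) (\<not> b)"
      by (metis replicate_eqI singletonD subsetD)
    with u have "w = replicate (length u) b @ replicate (length v) (\<not> b)"
      using 3(1) by simp
    then show ?thesis
      unfolding two_run_words_def by blast
  qed
qed

lemma card_two_run_words: "card (words_upto two_run_words n) \<le> 2 * (n + 1)\<^sup>2"
proof -
  let ?g = "\<lambda>(i, j, b). replicate i b @ replicate j (\<not> b)"
  have "words_upto two_run_words n \<subseteq> ?g ` ({..n} \<times> {..n} \<times> UNIV)"
  proof
    fix w assume "w \<in> words_upto two_run_words n"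
    then obtain i j b where "w = ?g (i, j, b)" "i \<le> n" "j \<le> n"
      by (auto simp: words_upto_def two_run_words_def)
    then show "w \<in> ?g ` ({..n} \<times> {..n} \<times> UNIV)"
      by (intro image_eqI[of _ _ "(i, j, b)"]) simp_all
  qed
  then have "card (words_upto two_run_words n) \<le> card ({..n} \<times> {..n} \<times> (UNIV :: bool set))"
    by (intro surj_card_le) simp_all
  then show ?thesis
    by (simp add: card_cartesian_product power2_eq_square)
qed

text \<open>\<open>T k\<close> holds the tuples of inner run lengths used at scale
  \<open>2 ^ k\<close>. As \<open>r \<ge> 1\<close>, there is an inner run, which reveals the scale;
  nonempty \<open>T k\<close> make the language infinite.\<close>

locale run_language =
  fixes r :: nat and T :: "nat \<Rightarrow> nat list set"
  assumes r_pos: "r \<ge> 1"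
    and T_subset: "T k \<subseteq> {ts. set ts \<subseteq> {2 ^ k..<2 ^ Suc k} \<and> length ts = r}"
    and T_nonempty: "T k \<noteq> {}"
begin

text \<open>Each outer run can be cut down to any length from 1 to \<open>2 ^ k\<close>, which gives
  \<open>4 ^ k\<close> factors with the same inner runs.\<close>

definition core :: "nat \<Rightarrow> nat list \<Rightarrow> bool list" where
  "core k ts = runs True (2 ^ k # ts @ [2 ^ k])"

text \<open>Scales start at 1, since at scale 0 every inner run has length 1 and there is no
  choice.\<close>

definition language :: "bool list set" where
  "language = {w. \<exists>k\<ge>1. \<exists>ts\<in>T k. sublist w (core k ts)}"

lemma finite_T: "finite (T k)"
  by (rule finite_subset[OF T_subset]) (simp add: finite_lists_length_eq)

lemma length_run_word:
  assumes "ts \<in> T k" "p \<le> 2 ^ k" "q \<le> 2 ^ k"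
  shows "length (runs b (p # ts @ [q])) \<le> (2 * r + 2) * 2 ^ k"
proof -
  have ts: "length ts = r" "\<forall>t\<in>set ts. t \<le> 2 * 2 ^ k"
    using T_subset[of k] assms(1) by force+
  have "sum_list ts \<le> r * (2 * 2 ^ k)"
    using sum_list_mono[of ts id "\<lambda>_. 2 * 2 ^ k"] ts by (simp add: sum_list_triv)
  then show ?thesis
    using assms(2,3) by (simp add: length_runs algebra_simps)
qed

lemma language_factor_closed: "u @ v \<in> language \<Longrightarrow> u \<in> language \<and> v \<in> language"
  unfolding language_def using sublist_order.order.trans sublist_append_leftI sublist_append_rightI
  by blast

lemma infinite_language: "infinite language"
proof
  assume "finite language"
  then have fin: "finite (length ` language)" by simp
  define k where "k = Suc (Max (length ` language))"
  obtain ts where "ts \<in> T k"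
    using T_nonempty by blast
  then have "core k ts \<in> language"
    unfolding language_def using k_def by (metis (mono_tags, lifting) le_add1 mem_Collect_eq plus_1_eq_Suc sublist_order.order.refl)
  then have "length (core k ts) < k"
    using Max_ge[OF fin] unfolding k_def by (simp add: less_Suc_eq_le)
  moreover have "2 ^ k \<le> length (core k ts)"
    by (simp add: core_def length_runs)
  ultimately show False
    using less_exp[of k] by linarith
qed

sublocale factorial_language language
  using language_factor_closed infinite_language by unfold_locales blast+

text \<open>At scales beyond \<open>K\<close>, a word of length at most \<open>n\<close> is no
  longer than a run, so it meets at most two. At the other scales all factors of each core are
  counted; their number is quadratic in its length.\<close>

lemma card_words_upto_le:
  assumes "2 ^ K \<le> n" "n < 2 ^ Suc K"
  shows "card (words_upto language n) \<le>
    2 * (n + 1)\<^sup>2 + (2 * r + 3)\<^sup>2 * (\<Sum>k\<in>{1..K}. card (T k) * 4 ^ k)"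
proof -
  let ?S = "\<lambda>k. \<Union>ts\<in>T k. set (sublists (core k ts))"
  have "words_upto language n \<subseteq> words_upto two_run_words n \<union> (\<Union>k\<in>{1..K}. ?S k)"
  proof
    fix w assume "w \<in> words_upto language n"
    then obtain k ts where w: "length w \<le> n" "k \<ge> 1" "ts \<in> T k" "sublist w (core k ts)"
      unfolding words_upto_def language_def by blast
    show "w \<in> words_upto two_run_words n \<union> (\<Union>k\<in>{1..K}. ?S k)"
    proof (cases "k \<le> K")
      case True
      then show ?thesis using w by auto
    next
      case False
      then have "(2 :: nat) ^ Suc K \<le> 2 ^ k"
        by (intro power_increasing) auto
      then have "length w \<le> 2 ^ k"
        using w(1) assms(2) by linarith
      moreover have "\<forall>t\<in>set (2 ^ k # ts @ [2 ^ k]). 2 ^ k \<le> t"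
        using subsetD[OF T_subset w(3)] by (auto dest!: subsetD)
      ultimately have "w \<in> two_run_words"
        using short_sublist_runs w(4) unfolding core_def by blast
      then show ?thesis using w(1) by (simp add: words_upto_def)
    qed
  qed
  then have "card (words_upto language n) \<le>
      card (words_upto two_run_words n \<union> (\<Union>k\<in>{1..K}. ?S k))"
    by (rule card_mono[rotated]) (simp add: finite_words_upto finite_T)
  also have "\<dots> \<le> card (words_upto two_run_words n) + card (\<Union>k\<in>{1..K}. ?S k)"
    by (rule card_Un_le)
  also have "card (\<Union>k\<in>{1..K}. ?S k) \<le> (\<Sum>k\<in>{1..K}. card (?S k))"
    by (rule card_UN_le) simp
  also have "\<dots> \<le> (\<Sum>k\<in>{1..K}. (2 * r + 3)\<^sup>2 * (card (T k) * 4 ^ k))"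
  proof (rule sum_mono)
    fix k
    have "card (set (sublists (core k ts))) \<le> (2 * r + 3)\<^sup>2 * 4 ^ k" if "ts \<in> T k" for ts
    proof -
      let ?l = "length (core k ts)"
      have "?l \<le> (2 * r + 2) * 2 ^ k"
        unfolding core_def using that by (intro length_run_word) auto
      moreover have "(2 * r + 3) * 2 ^ k = (2 * r + 2) * 2 ^ k + 2 ^ k" "(1 :: nat) \<le> 2 ^ k"
        by (simp_all add: algebra_simps)
      ultimately have l: "Suc ?l \<le> (2 * r + 3) * 2 ^ k"
        by linarith
      have "card (set (sublists (core k ts))) \<le> Suc (?l * Suc ?l div 2)"
        by (metis card_length length_sublists)
      also have "\<dots> \<le> (Suc ?l)\<^sup>2"
        by (simp add: power2_eq_square)
      also have "\<dots> \<le> ((2 * r + 3) * 2 ^ k)\<^sup>2"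
        using l by (rule power_mono) simp
      also have "\<dots> = (2 * r + 3)\<^sup>2 * 4 ^ k"
        by (simp add: power_mult_distrib power2_eq_square flip: power_mult_distrib)
      finally show ?thesis .
    qed
    then have "(\<Sum>ts\<in>T k. card (set (sublists (core k ts)))) \<le> card (T k) * ((2 * r + 3)\<^sup>2 * 4 ^ k)"
      using sum_bounded_above by (metis (no_types, lifting) of_nat_id)
    then show "card (?S k) \<le> (2 * r + 3)\<^sup>2 * (card (T k) * 4 ^ k)"
      using card_UN_le[OF finite_T, of "\<lambda>ts. set (sublists (core k ts))" k]
      by (simp add: algebra_simps)
  qed
  finally show ?thesis
    using card_two_run_words[of n] by (simp add: sum_distrib_left)
qed

text \<open>Cutting the outer runs to positive lengths \<open>p\<close> and \<open>q\<close> stays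
  in the language, and the word determines its run lengths, so each tuple at scale
  \<open>2 ^ k\<close> accounts for \<open>4 ^ k\<close> words of its own.\<close>

lemma sum_le_card_words_upto:
  "(\<Sum>k\<in>{1..K}. card (T k) * 4 ^ k) \<le> card (words_upto language ((2 * r + 2) * 2 ^ K))"
proof -
  let ?A = "SIGMA k:{1..K}. T k \<times> {1..2 ^ k :: nat} \<times> {1..2 ^ k :: nat}"
  let ?g = "\<lambda>(k, ts, p, q). runs True (p # ts @ [q])"
  have "2 ^ k * 2 ^ k = (4 :: nat) ^ k" for k
    by (simp flip: power_mult_distrib)
  then have card_A: "card ?A = (\<Sum>k\<in>{1..K}. card (T k) * 4 ^ k)"
    by (simp add: finite_T card_cartesian_product)
  have inj: "inj_on ?g ?A"
  proof (rule inj_onI, clarsimp)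
    fix k ts p q k' ts' p' q'
    assume k: "Suc 0 \<le> k" "Suc 0 \<le> k'" and ts: "ts \<in> T k" "ts' \<in> T k'"
      and pq: "Suc 0 \<le> p" "Suc 0 \<le> q" "Suc 0 \<le> p'" "Suc 0 \<le> q'"
      and eq: "replicate p True @ runs False (ts @ [q]) = replicate p' True @ runs False (ts' @ [q'])"
    have tsr: "set ts \<subseteq> {2 ^ k..<2 ^ Suc k}" "length ts = r"
      "set ts' \<subseteq> {2 ^ k'..<2 ^ Suc k'}" "length ts' = r"
      using subsetD[OF T_subset ts(1)] subsetD[OF T_subset ts(2)] by simp_all
    then have "0 \<notin> set ts" "0 \<notin> set ts'"
      by force+
    then have "p # ts @ [q] = p' # ts' @ [q']"
      using pq eq by (intro runs_inject[of _ _ True]) auto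
    then have e: "p = p'" "ts = ts'" "q = q'"
      by auto
    \<comment> \<open>An inner run lies in the dyadic intervals of both scales, so the scales
      agree.\<close>
    obtain t where "t \<in> set ts"
      using tsr(2) r_pos by (cases ts) auto
    then have "(2 :: nat) ^ k < 2 ^ Suc k'" "(2 :: nat) ^ k' < 2 ^ Suc k"
      using tsr e by fastforce+
    then have "k < Suc k'" "k' < Suc k"
      by (auto intro: power_less_imp_less_exp[of "2 :: nat"] simp del: power_Suc)
    then have "k = k'"
      by simp
    then show "k = k' \<and> ts = ts' \<and> p = p' \<and> q = q'"
      using e by simp
  qed
  have "?g ` ?A \<subseteq> words_upto language ((2 * r + 2) * 2 ^ K)"
  proof (clarify)
    fix k ts p q
    assume k: "k \<in> {1..K}" "ts \<in> T k" "p \<in> {1..(2 :: nat) ^ k}" "q \<in> {1..(2 :: nat) ^ k}"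
    then have "sublist (runs True (p # ts @ [q])) (core k ts)"
      unfolding core_def by (intro sublist_runs_ends) auto
    then have "runs True (p # ts @ [q]) \<in> language"
      unfolding language_def using k by auto
    moreover have "length (runs True (p # ts @ [q])) \<le> (2 * r + 2) * 2 ^ k"
      using k by (intro length_run_word) auto
    moreover have "(2 * r + 2) * 2 ^ k \<le> (2 * r + 2) * (2 :: nat) ^ K"
      using k by (intro mult_left_mono power_increasing) auto
    ultimately show "runs True (p # ts @ [q]) \<in> words_upto language ((2 * r + 2) * 2 ^ K)"
      unfolding words_upto_def by simp
  qed
  then have "card (?g ` ?A) \<le> card (words_upto language ((2 * r + 2) * 2 ^ K))"
    by (intro card_mono finite_words_upto)
  then show ?thesis
    by (simp only: card_image[OF inj] card_A)
qed

end

subsection \<open>Prescribing the growth\<close>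

text \<open>As \<open>2 ^ k \<ge> 2\<close>, a power of it absorbs the constant factor. The added 1
  leaves room for the extra tuple of each scale.\<close>

lemma polynomially_bounded_imp_power_bound:
  assumes "polynomially_bounded f"
  obtains r where "r \<ge> 1" "\<And>k. k \<ge> 1 \<Longrightarrow> f (2 ^ k) + 1 \<le> (2 ^ k) ^ r"
proof -
  obtain K d :: real where K: "K > 0" "d > 0" "\<And>n. n \<ge> 1 \<Longrightarrow> real (f n) \<le> K * real n powr d"
    using assms unfolding polynomially_bounded_def by blast
  obtain s where s: "K + 1 < 2 ^ s"
    using real_arch_pow[of 2 "K + 1"] by auto
  obtain e :: nat where e: "d \<le> real e"
    using real_arch_simple by blast
  \<comment> \<open>Here \<open>s\<close> absorbs the constant, \<open>e\<close> rounds up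
    \<open>d\<close>, and the final 1 makes \<open>r\<close> positive.\<close>
  have "f (2 ^ k) + 1 \<le> (2 ^ k) ^ (s + e + 1)" if "k \<ge> 1" for k
  proof -
    have k2: "(2 :: real) ^ k \<ge> 1" by simp
    have "real (f (2 ^ k)) \<le> K * (2 ^ k) powr d"
      using K(3)[of "2 ^ k"] by simp
    also have "\<dots> \<le> K * (2 ^ k) powr (real e)"
      using K(1) e k2 by (intro mult_left_mono powr_mono) auto
    also have "(2 ^ k :: real) powr (real e) = (2 ^ k) ^ e"
      by (simp add: powr_realpow)
    finally have "real (f (2 ^ k)) + 1 \<le> K * (2 ^ k) ^ e + (2 ^ k) ^ e"
      using one_le_power[OF k2, of e] by linarith
    also have "\<dots> = (K + 1) * (2 ^ k) ^ e"
      by (simp add: algebra_simps)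
    also have "\<dots> \<le> (2 ^ k) ^ s * (2 ^ k) ^ e"
    proof (rule mult_right_mono)
      have "(2 :: real) ^ 1 \<le> 2 ^ k"
        using that by (intro power_increasing) auto
      then have "(2 :: real) ^ s \<le> (2 ^ k) ^ s"
        by (intro power_mono) auto
      then show "K + 1 \<le> (2 ^ k) ^ s"
        using s by linarith
    qed simp
    also have "\<dots> \<le> (2 ^ k) ^ (s + e + 1)"
      using k2 by (simp add: power_add)
    finally have "real (f (2 ^ k) + 1) \<le> real ((2 ^ k) ^ (s + e + 1))"
      by simp
    then show ?thesis
      by (simp only: of_nat_le_iff)
  qed
  then show ?thesis
    by (intro that[of "s + e + 1"]) auto
qed

lemma sum_power4_le: "(\<Sum>k\<in>{1..K}. (4 :: nat) ^ k) \<le> 2 * 4 ^ K"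
  by (induction K) auto

lemma dyadic_interval:
  assumes "n \<ge> (1 :: nat)"
  obtains K where "2 ^ K \<le> n" "n < 2 ^ Suc K"
  using ex_power_ivl1[of 2 n] assms by auto

context run_language
begin

text \<open>Each word of scale \<open>2 ^ k\<close> contributes about \<open>4 ^ k\<close> factors, so \<open>card (T k)\<close> words make up
  the increment of \<open>f\<close> from \<open>2 ^ (k - 1)\<close> to \<open>2 ^ k\<close>. The summand \<open>1\<close> keeps \<open>T k\<close> nonempty at the cost
  of a quadratic term, which \<open>f\<close> absorbs.\<close>

lemma words_upto_growth_equiv:
  assumes mono: "\<And>m n. 1 \<le> m \<Longrightarrow> m \<le> n \<Longrightarrow> f m \<le> f n"
    and square: "(\<lambda>n. n\<^sup>2) \<preceq> f"
    and card_T: "\<And>k. k \<ge> 1 \<Longrightarrow> card (T k) = (f (2 ^ k) - f (2 ^ (k - 1))) div 4 ^ k + 1"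
  shows "(\<lambda>n. card (words_upto language n)) \<approx> f"
proof -
  let ?h = "\<lambda>n. card (words_upto language n)"
  define E where "E = (2 * r + 3)\<^sup>2"
  have telescope: "f 1 + (\<Sum>k\<in>{1..K}. f (2 ^ k) - f (2 ^ (k - 1))) = f (2 ^ K)" for K
  proof (induction K)
    case (Suc K)
    \<comment> \<open>Monotonicity makes the truncated subtraction exact.\<close>
    have "f (2 ^ K) \<le> f (2 ^ Suc K)"
      by (intro mono) auto
    then show ?case using Suc by simp
  qed simp
  have upper_T: "(\<Sum>k\<in>{1..K}. card (T k) * 4 ^ k) \<le> f (2 ^ K) + 2 * 4 ^ K" for K
  proof -
    \<comment> \<open>The quotient rounds down, so only the summand 1 can exceed the
      increment.\<close>
    have "card (T k) * 4 ^ k \<le> (f (2 ^ k) - f (2 ^ (k - 1))) + 4 ^ k" if "k \<in> {1..K}" for k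
      using that card_T[of k] by (simp add: div_times_less_eq_dividend)
    then have "(\<Sum>k\<in>{1..K}. card (T k) * 4 ^ k) \<le>
        (\<Sum>k\<in>{1..K}. (f (2 ^ k) - f (2 ^ (k - 1))) + 4 ^ k)"
      by (rule sum_mono)
    then show ?thesis
      using telescope[of K] sum_power4_le[of K] by (simp add: sum.distrib)
  qed
  have lower_T: "f (2 ^ K) \<le> f 1 + (\<Sum>k\<in>{1..K}. card (T k) * 4 ^ k)" for K
  proof -
    \<comment> \<open>The summand 1 makes up for the rounding.\<close>
    have "f (2 ^ k) - f (2 ^ (k - 1)) \<le> card (T k) * 4 ^ k" if "k \<in> {1..K}" for k
      using that card_T[of k] dividend_less_div_times[of "4 ^ k" "f (2 ^ k) - f (2 ^ (k - 1))"]
      by simp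
    then have "(\<Sum>k\<in>{1..K}. f (2 ^ k) - f (2 ^ (k - 1))) \<le> (\<Sum>k\<in>{1..K}. card (T k) * 4 ^ k)"
      by (rule sum_mono)
    then show ?thesis
      using telescope[of K] by linarith
  qed
  have "f n \<le> (f 1 + 1) * ?h ((4 * r + 4) * n)" if n: "n \<ge> 1" for n
  proof -
    obtain K where K: "2 ^ K \<le> n" "n < 2 ^ Suc K"
      using dyadic_interval[OF n] by blast
    let ?m = "(4 * r + 4) * n"
    \<comment> \<open>The scale \<open>Suc K\<close> lies above \<open>n\<close>, so
      \<open>lower_T\<close> there bounds \<open>f n\<close>, and the words counted still fit into
      length \<open>?m\<close>.\<close>
    have "(2 * r + 2) * 2 ^ Suc K \<le> ?m"
      using mult_left_mono[OF K(1), of "4 * r + 4"] by (simp add: algebra_simps)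
    then have "?h ((2 * r + 2) * 2 ^ Suc K) \<le> ?h ?m"
      by (intro card_mono finite_words_upto) (auto simp: words_upto_def)
    moreover have "f n \<le> f (2 ^ Suc K)"
      using K(2) n by (intro mono) auto
    ultimately have "f n \<le> f 1 + ?h ?m"
      using lower_T[of "Suc K"] sum_le_card_words_upto[of "Suc K"] by linarith
    \<comment> \<open>The empty word ensures a positive count, so the additive constant
      \<open>f 1\<close> can become a factor.\<close>
    moreover have "?h ?m \<ge> 1"
    proof -
      have "[] \<in> words_upto language ?m"
        using Nil_mem_language by (simp add: words_upto_def)
      then show ?thesis
        by (metis One_nat_def Suc_leI card_gt_0_iff empty_iff finite_words_upto)
    qed
    then have "f 1 * 1 \<le> f 1 * ?h ?m"
      by (rule mult_left_mono) simp
    ultimately have "f n \<le> f 1 * ?h ?m + ?h ?m"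
      by linarith
    then show ?thesis
      by (simp only: distrib_right mult_1)
  qed
  then have lower: "f \<preceq> ?h"
    by (intro asymp_leI_nat[of "4 * r + 4" _ "f 1 + 1"]) auto
  obtain C :: real and D :: nat where CD: "C > 0" "D > 0"
    "\<And>n. n \<ge> 1 \<Longrightarrow> real (n\<^sup>2) \<le> C * real (f (D * n))"
    using square unfolding asymp_le_def by blast
  \<comment> \<open>The 8 stems from the two-run words and \<open>2 * E\<close> from the extra tuple
    of each scale; \<open>square\<close> turns these multiples of \<open>n\<^sup>2\<close> into
    multiples of \<open>f (D * n)\<close>.\<close>
  have "real (?h n) \<le> (real (8 + 2 * E) * C + real E) * real (f (D * n))" if n: "n \<ge> 1" for n
  proof -
    obtain K where K: "2 ^ K \<le> n" "n < 2 ^ Suc K"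
      using dyadic_interval[OF n] by blast
    have "(4 :: nat) ^ K = (2 ^ K)\<^sup>2"
      by (simp add: power2_eq_square flip: power_mult_distrib)
    also have "\<dots> \<le> n\<^sup>2"
      using K(1) by (rule power_mono) simp
    finally have "(\<Sum>k\<in>{1..K}. card (T k) * 4 ^ k) \<le> f (2 ^ K) + 2 * n\<^sup>2"
      using upper_T[of K] by linarith
    moreover have "f (2 ^ K) \<le> f (D * n)"
      using K(1) CD(2) by (intro mono) (auto intro: order_trans)
    ultimately have "E * (\<Sum>k\<in>{1..K}. card (T k) * 4 ^ k) \<le> E * (f (D * n) + 2 * n\<^sup>2)"
      by (intro mult_left_mono) auto
    moreover have "2 * (n + 1)\<^sup>2 \<le> 8 * n\<^sup>2"
      using power_mono[of "n + 1" "2 * n" 2] n by (simp add: power_mult_distrib)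
    ultimately have "?h n \<le> (8 + 2 * E) * n\<^sup>2 + E * f (D * n)"
      using card_words_upto_le[OF K] unfolding E_def[symmetric] by (simp add: algebra_simps)
    then have "real (?h n) \<le> real (8 + 2 * E) * real (n\<^sup>2) + real E * real (f (D * n))"
      by (metis of_nat_add of_nat_le_iff of_nat_mult)
    also have "\<dots> \<le> real (8 + 2 * E) * (C * real (f (D * n))) + real E * real (f (D * n))"
      using CD(3)[OF n] by (intro add_right_mono mult_left_mono) auto
    finally show ?thesis
      by (simp add: algebra_simps)
  qed
  moreover have "real (8 + 2 * E) * C + real E > 0"
    using CD(1) by (intro add_pos_nonneg mult_pos_pos) auto
  ultimately have "?h \<preceq> f"
    unfolding asymp_le_def using CD(2) by blast
  with lower show ?thesis
    unfolding growth_equiv_def by blast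
qed

end

theorem corollary4p1:
  fixes f :: "nat \<Rightarrow> nat"
  assumes "CHAR('k::field) \<noteq> 2"
    and "strict_mono_on {1..} f"
    and "polynomially_bounded f"
    and "(\<lambda>n. n\<^sup>2) \<preceq> f"
  shows "\<exists>(scale :: 'k \<Rightarrow> (nat \<Rightarrow>\<^sub>0 'k) \<Rightarrow> (nat \<Rightarrow>\<^sub>0 'k)) mul.
           jordan_algebra scale mul \<and> has_growth scale mul f"
proof -
  obtain r where r: "r \<ge> 1" "\<And>k. k \<ge> 1 \<Longrightarrow> f (2 ^ k) + 1 \<le> (2 ^ k) ^ r"
    using polynomially_bounded_imp_power_bound[OF assms(3)] by blast
  \<comment> \<open>At \<open>k = 0\<close>, where no scale precedes, the value 1 keeps
    \<open>T 0\<close> nonempty.\<close>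
  define c where "c k = (if k \<ge> 1 then (f (2 ^ k) - f (2 ^ (k - 1))) div 4 ^ k + 1 else 1)" for k
  have "\<exists>S. S \<subseteq> {ts. set ts \<subseteq> {2 ^ k..<2 ^ Suc k :: nat} \<and> length ts = r} \<and> card S = c k" for k
  proof -
    \<comment> \<open>There are enough tuples, as each of the \<open>r\<close> inner runs has
      \<open>2 ^ k\<close> possible lengths.\<close>
    have "c k \<le> (2 ^ k) ^ r"
    proof (cases "k \<ge> 1")
      case True
      then have "c k \<le> f (2 ^ k) + 1"
        using div_le_dividend[of "f (2 ^ k) - f (2 ^ (k - 1))" "4 ^ k"] unfolding c_def
        by (simp del: div_le_dividend)
      then show ?thesis
        using r(2)[OF True] by (rule order_trans)
    qed (simp add: c_def)
    also have "\<dots> = card {ts. set ts \<subseteq> {2 ^ k..<2 ^ Suc k :: nat} \<and> length ts = r}"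
      by (simp add: card_lists_length_eq)
    finally show ?thesis
      by (meson obtain_subset_with_card_n)
  qed
  then obtain T where
    T: "T k \<subseteq> {ts. set ts \<subseteq> {2 ^ k..<2 ^ Suc k :: nat} \<and> length ts = r}"
      "card (T k) = c k" for k
    by metis
  have "c k \<noteq> 0" for k
    by (simp add: c_def)
  then have "T k \<noteq> {}" for k
    by (metis T(2) card.empty)
  then interpret run_language r T
    using r(1) T(1) by unfold_locales
  have mono: "f m \<le> f n" if "1 \<le> m" "m \<le> n" for m n
    using strict_mono_on_leD[OF assms(2)] that by simp
  have "(\<lambda>n. card (words_upto language n)) \<approx> f"
    using mono assms(4) by (rule words_upto_growth_equiv) (simp_all add: T(2) c_def)
  then show ?thesis
    using has_growth_language[OF assms(1)] jordan_algebra_jordan_mul by blast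
qed

end
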